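(* Let $\Omega=\mathbb R\times\Omega'\subset\mathbb R^n$ for some bounded domain $\Omega'\subset\mathbb R^{n-1}$, and assume that $\Omega$ satisfies a uniform exterior sphere condition. Let $a^{ij},b^i,c\in C^0(\overline\Omega,\mathbb R)$ ($i,j=1,\dots,n$) be such that the matrix $(a^{ij}(x))$ is symmetric and positive definite for every $x\in\overline\Omega$. Assume there are constants $H<\infty$ and $\Lambda<\infty$ with $$\|a^{ij}\|_{C^0(\Omega)}+\|b^i\|_{C^0(\Omega)}+\|c\|_{C^0(\Omega)}\le H\quad (i,j=1,\dots,n),\qquad c(x)\le 0\ \text{ in }\Omega,$$ $$\frac1\Lambda|\xi|^2\le a^{ij}(x)\xi_i\xi_j\le\Lambda|\xi|^2\quad\text{for all }x\in\Omega,\ \xi\in\mathbb R^n.$$ Let $f:\Omega\to\mathbb R$ and $g:\partial\Omega\to\mathbb R$, and assume that the coefficients $a^{ij},b^i,c$, the right side $f$ and the boundary values $g$ are all periodic with respect to the $x_1$-variable with one and the same period length $L>0$. Then any bounded solution $u\in C^2(\Omega,\mathbb R)\cap C^0(\overline\Omega,\mathbb R)$ of $$a^{ij}(x)\partial_{ij}u+b^i(x)\partial_iu+c(x)u=f\ \text{ in }\Omega,\qquad u=g\ \text{ on }\partial\Omega,$$ is periodic with respect to the $x_1$-variable.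
   Context: A domain is a nonempty connected open set. The summation convention is used: repeated indices $i,j$ are summed from $1$ to $n$. $\partial_i,\partial_{ij}$ denote first and second partial derivatives. $\|\cdot\|_{C^0(\Omega)}$ is the supremum norm on $\Omega$. Uniform exterior sphere condition: there exists some $r>0$ such that for each $x_0\in\partial\Omega$ there exists some $x_1\in\mathbb R^n$ with $\overline{B_r(x_1)}\cap\overline\Omega=\{x_0\}$, where $B_r(x_1)$ is the open ball of radius $r$ centered at the point $x_1$. A function $h$ on $\Omega$, $\overline\Omega$ or $\partial\Omega$ is periodic with respect to the $x_1$-variable with period length $T>0$ if $h(x_1+T,x_2,\dots,x_n)=h(x_1,x_2,\dots,x_n)$ for all points $(x_1,\dots,x_n)$ of its domain of definition (where $x_1$ is the first coordinate); it is periodic with respect to the $x_1$-variable if this holds for some $T>0$. *)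

theory Defs
  imports "HOL-Analysis.Analysis"
begin

definition domain_set :: "'a::euclidean_space set \<Rightarrow> bool" where
  "domain_set S \<longleftrightarrow> S \<noteq> {} \<and> open S \<and> connected S"

definition uniform_exterior_sphere :: "'a::euclidean_space set \<Rightarrow> bool" where
  "uniform_exterior_sphere S \<longleftrightarrow>
     (\<exists>r>0. \<forall>x0\<in>frontier S. \<exists>x1. closure (ball x1 r) \<inter> closure S = {x0})"

(* Extended-real valued, so that an unbounded function has norm \<infinity>
   (the real-valued SUP would be unspecified there). *)
definition C0_norm :: "'a set \<Rightarrow> ('a \<Rightarrow> real) \<Rightarrow> ereal" where
  "C0_norm S h = (SUP x\<in>S. ereal \<bar>h x\<bar>)"

definition partial :: "'a::euclidean_space \<Rightarrow> ('a \<Rightarrow> real) \<Rightarrow> 'a \<Rightarrow> real" where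
  "partial e u x = deriv (\<lambda>t. u (x + t *\<^sub>R e)) 0"

(* u is k times continuously differentiable on S: all partial derivatives up to order k
   exist and are continuous on S. Meant for open S. *)
primrec Ck_on :: "nat \<Rightarrow> 'a::euclidean_space set \<Rightarrow> ('a \<Rightarrow> real) \<Rightarrow> bool" where
  "Ck_on 0 S u \<longleftrightarrow> continuous_on S u"
| "Ck_on (Suc k) S u \<longleftrightarrow> continuous_on S u \<and>
     (\<forall>e\<in>Basis. (\<forall>x\<in>S. (\<lambda>t. u (x + t *\<^sub>R e)) field_differentiable (at 0)) \<and>
                Ck_on k S (partial e u))"

(* Points of R x R^(n-1) are pairs, the first component being the x_1-variable. D is the
   domain of definition of h; it is meant to be invariant under translation in x_1. *)
definition periodic_x1 ::
  "(real \<times> 'b) set \<Rightarrow> real \<Rightarrow> (real \<times> 'b \<Rightarrow> real) \<Rightarrow> bool" where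
  "periodic_x1 D T h \<longleftrightarrow> T > 0 \<and> (\<forall>(s, y)\<in>D. h (s + T, y) = h (s, y))"

end

theory Submission
  imports Defs
begin

text \<open>The difference \<open>w(x) = u(x + (L, 0)) - u(x)\<close> is a bounded solution of the homogeneous
  equation vanishing on the boundary. The function
  \<open>\<phi>(s, y) = sqrt (1 + s\<^sup>2) + M (exp (\<alpha> R) - exp (\<alpha> y\<^sub>k))\<close> satisfies \<open>\<phi> \<ge> \<bar>s\<bar>\<close> and, for suitable constants,
  is a strict supersolution, since the derivatives of \<open>sqrt (1 + s\<^sup>2)\<close> up to second order are bounded and
  \<open>y\<close> stays bounded. For every \<open>\<epsilon> > 0\<close> the function \<open>w - \<epsilon> \<phi>\<close> is negative for large \<open>\<bar>s\<bar>\<close>, so if it were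
  positive somewhere it would have a positive interior maximum, where the equation is violated. Hence
  \<open>w \<le> 0\<close>, and \<open>- w \<le> 0\<close> likewise.\<close>

section \<open>Differentiability from continuous partial derivatives\<close>

text \<open>Walk from \<open>x\<close> to a nearby \<open>y\<close> one coordinate at a time. On
  each segment the partial derivative stays close to its value at \<open>x\<close>, so the mean
  value inequality controls the error. This turns the coordinatewise notion \<open>Ck_on\<close>
  into total differentiability, which the chain rule along arbitrary directions requires.\<close>

lemma has_derivative_continuous_partials:
  fixes f :: "'a::euclidean_space \<Rightarrow> real"
  assumes "open S" "x \<in> S"
    and F: "\<And>e y. e \<in> Basis \<Longrightarrow> y \<in> S \<Longrightarrow> ((\<lambda>t. f (y + t *\<^sub>R e)) has_real_derivative F e y) (at 0)"
    and cont: "\<And>e. e \<in> Basis \<Longrightarrow> continuous_on S (F e)"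
  shows "(f has_derivative (\<lambda>h. \<Sum>e\<in>Basis. (h \<bullet> e) * F e x)) (at x)"
  unfolding has_derivative_at_alt
proof (intro conjI allI impI)
  show "bounded_linear (\<lambda>h. \<Sum>e\<in>Basis. (h \<bullet> e) * F e x)"
    by (intro bounded_linear_intros)
next
  fix \<epsilon> :: real assume "\<epsilon> > 0"
  \<comment> \<open>One error \<open>\<eta>\<close> is spent per coordinate, \<open>DIM('a)\<close>
    of them in all.\<close>
  define \<eta> where "\<eta> = \<epsilon> / DIM('a)"
  have "\<eta> > 0" using \<open>\<epsilon> > 0\<close> by (simp add: \<eta>_def)
  have "\<forall>e\<in>Basis. \<exists>d>0. \<forall>y\<in>S. dist y x < d \<longrightarrow> dist (F e y) (F e x) < \<eta>"
    using cont \<open>x \<in> S\<close> \<open>\<eta> > 0\<close> unfolding continuous_on_iff by blast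
  then obtain d where d: "\<And>e. e \<in> Basis \<Longrightarrow> d e > 0 \<and> (\<forall>y\<in>S. dist y x < d e \<longrightarrow> dist (F e y) (F e x) < \<eta>)"
    by metis
  obtain r where r: "r > 0" "ball x r \<subseteq> S"
    using assms(1,2) open_contains_ball by blast
  define \<delta> where "\<delta> = Min (insert r (d ` Basis))"
  have "\<delta> > 0" unfolding \<delta>_def using r d by auto
  have \<delta>r: "\<delta> \<le> r" and \<delta>d: "\<And>e. e \<in> Basis \<Longrightarrow> \<delta> \<le> d e"
    unfolding \<delta>_def by (rule Min_le; simp)+
  have near: "y \<in> S" "e \<in> Basis \<Longrightarrow> \<bar>F e y - F e x\<bar> \<le> \<eta>" if "norm (y - x) < \<delta>" for y e
  proof -
    show "y \<in> S" using that r(2) \<delta>r by (auto simp: dist_norm norm_minus_commute)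
    then show "\<bar>F e y - F e x\<bar> \<le> \<eta>" if "e \<in> Basis"
      using d[OF that] \<delta>d[OF that] \<open>norm (y - x) < \<delta>\<close> by (force simp: dist_norm)
  qed
  show "\<exists>d>0. \<forall>y. norm (y - x) < d \<longrightarrow>
      norm (f y - f x - (\<Sum>e\<in>Basis. ((y - x) \<bullet> e) * F e x)) \<le> \<epsilon> * norm (y - x)"
  proof (intro exI[of _ \<delta>] conjI allI impI \<open>\<delta> > 0\<close>)
    fix y assume y: "norm (y - x) < \<delta>"
    define h where "h = y - x"
    \<comment> \<open>Every point of the coordinate path differs from \<open>x\<close> by a vector
      that is coordinatewise no larger than \<open>h\<close>, so the whole path stays within
      distance \<open>\<delta>\<close> of \<open>x\<close>.\<close>
    have part: "norm (\<Sum>e\<in>B. s e *\<^sub>R e) < \<delta>" if "B \<subseteq> Basis" "\<And>e. e \<in> B \<Longrightarrow> \<bar>s e\<bar> \<le> \<bar>h \<bullet> e\<bar>" for B s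
    proof -
      have "norm (\<Sum>e\<in>B. s e *\<^sub>R e) \<le> norm h"
      proof (rule norm_le_componentwise)
        fix b :: 'a assume b: "b \<in> Basis"
        have "(\<Sum>e\<in>B. s e *\<^sub>R e) \<bullet> b = (\<Sum>e\<in>B. if e = b then s e else 0)"
          unfolding inner_sum_left using that(1) b by (intro sum.cong) (auto simp: inner_Basis)
        also have "\<dots> = (if b \<in> B then s b else 0)"
          using finite_subset[OF that(1) finite_Basis] by (simp add: sum.delta)
        finally show "\<bar>(\<Sum>e\<in>B. s e *\<^sub>R e) \<bullet> b\<bar> \<le> \<bar>h \<bullet> b\<bar>" using that(2) by auto
      qed
      then show ?thesis using y h_def by simp
    qed
    \<comment> \<open>Induction over the set \<open>B\<close> of coordinates already moved.\<close>
    have "\<bar>f (x + (\<Sum>e\<in>B. (h \<bullet> e) *\<^sub>R e)) - f x - (\<Sum>e\<in>B. (h \<bullet> e) * F e x)\<bar> \<le> (\<Sum>e\<in>B. \<eta> * \<bar>h \<bullet> e\<bar>)"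
      if "finite B" "B \<subseteq> Basis" for B
      using that
    proof (induction B rule: finite_induct)
      case (insert e B)
      define z where "z = x + (\<Sum>e\<in>B. (h \<bullet> e) *\<^sub>R e)"
      \<comment> \<open>Subtracting the linear term leaves a function whose derivative is a
        difference of values of \<open>F e\<close>, hence at most \<open>\<eta>\<close> in absolute
        value on the segment.\<close>
      define q where "q = (\<lambda>t. f (z + t *\<^sub>R e) - t * F e x)"
      have e: "e \<in> Basis" using insert by auto
      have z: "norm (z + t *\<^sub>R e - x) < \<delta>" if "\<bar>t\<bar> \<le> \<bar>h \<bullet> e\<bar>" for t
      proof -
        have "(\<Sum>i\<in>insert e B. (if i = e then t else h \<bullet> i) *\<^sub>R i) = t *\<^sub>R e + (\<Sum>i\<in>B. (h \<bullet> i) *\<^sub>R i)"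
          using insert(1,2) by (auto intro!: sum.cong)
        then show ?thesis
          using part[of "insert e B" "\<lambda>i. if i = e then t else h \<bullet> i"] insert.prems that
          by (simp add: z_def algebra_simps)
      qed
      have dq: "(q has_real_derivative (F e (z + t *\<^sub>R e) - F e x)) (at t)" if "\<bar>t\<bar> \<le> \<bar>h \<bullet> e\<bar>" for t
      proof -
        \<comment> \<open>\<open>F\<close> describes derivatives at parameter 0 only, so it is
          applied at the base point \<open>z + t *\<^sub>R e\<close> and the parameter is then
          shifted.\<close>
        have "((\<lambda>s. f (z + t *\<^sub>R e + s *\<^sub>R e)) has_real_derivative F e (z + t *\<^sub>R e)) (at (t - t))"
          using F[OF e near(1)[OF z[OF that]]] by simp
        then have "((\<lambda>s. f (z + t *\<^sub>R e + (s - t) *\<^sub>R e)) has_real_derivative F e (z + t *\<^sub>R e)) (at t)"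
          using DERIV_chain2[where f="\<lambda>s. f (z + t *\<^sub>R e + s *\<^sub>R e)" and g="\<lambda>s. s - t" and x=t,
              OF _ DERIV_diff[OF DERIV_ident DERIV_const]] by simp
        then have "((\<lambda>s. f (z + s *\<^sub>R e)) has_real_derivative F e (z + t *\<^sub>R e)) (at t)"
          by (simp add: algebra_simps)
        then show ?thesis unfolding q_def by (auto intro!: derivative_eq_intros)
      qed
      have "norm (q (h \<bullet> e) - q 0) \<le> \<eta> * norm (h \<bullet> e - 0)"
      proof (rule field_differentiable_bound)
        show "convex {-\<bar>h \<bullet> e\<bar>..\<bar>h \<bullet> e\<bar>}" by simp
        show "(q has_field_derivative (F e (z + t *\<^sub>R e) - F e x)) (at t within {-\<bar>h \<bullet> e\<bar>..\<bar>h \<bullet> e\<bar>})"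
          if "t \<in> {-\<bar>h \<bullet> e\<bar>..\<bar>h \<bullet> e\<bar>}" for t
          using that by (intro has_field_derivative_at_within[OF dq]) (simp add: abs_le_iff)
        show "norm (F e (z + t *\<^sub>R e) - F e x) \<le> \<eta>" if "t \<in> {-\<bar>h \<bullet> e\<bar>..\<bar>h \<bullet> e\<bar>}" for t
          using near(2)[OF z e] that by auto
      qed auto
      then have 1: "\<bar>f (z + (h \<bullet> e) *\<^sub>R e) - f z - (h \<bullet> e) * F e x\<bar> \<le> \<eta> * \<bar>h \<bullet> e\<bar>"
        by (simp add: q_def)
      have 2: "\<bar>f z - f x - (\<Sum>e\<in>B. (h \<bullet> e) * F e x)\<bar> \<le> (\<Sum>e\<in>B. \<eta> * \<bar>h \<bullet> e\<bar>)"
        using insert by (simp add: z_def)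
      have 3: "x + (\<Sum>e\<in>insert e B. (h \<bullet> e) *\<^sub>R e) = z + (h \<bullet> e) *\<^sub>R e"
        using insert(1,2) by (simp add: z_def)
      show ?case unfolding 3 using 1 2 insert(1,2) by simp
    qed simp
    from this[of Basis] have "\<bar>f y - f x - (\<Sum>e\<in>Basis. (h \<bullet> e) * F e x)\<bar> \<le> (\<Sum>e\<in>Basis. \<eta> * \<bar>h \<bullet> e\<bar>)"
      by (simp add: euclidean_representation h_def)
    also have "\<dots> \<le> (\<Sum>e\<in>(Basis::'a set). \<eta> * norm h)"
      using \<open>\<eta> > 0\<close> by (intro sum_mono mult_left_mono Basis_le_norm) auto
    also have "\<dots> = \<epsilon> * norm h" by (simp add: \<eta>_def)
    finally show "norm (f y - f x - (\<Sum>e\<in>Basis. ((y - x) \<bullet> e) * F e x)) \<le> \<epsilon> * norm (y - x)"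
      by (simp add: h_def)
  qed
qed

section \<open>Contraction of a positive definite matrix with a nonpositive form\<close>

text \<open>The Schur complement of a positive definite matrix is positive definite, so one index at a
  time splits off and contributes a nonnegative multiple of a value of the quadratic form \<open>h\<close>.\<close>
lemma pos_def_contraction_nonpos:
  fixes a h :: "'i \<Rightarrow> 'i \<Rightarrow> real"
  assumes "finite S"
    and "\<And>i j. i \<in> S \<Longrightarrow> j \<in> S \<Longrightarrow> a i j = a j i"
    and "\<And>\<xi>. (\<exists>i\<in>S. \<xi> i \<noteq> 0) \<Longrightarrow> (\<Sum>i\<in>S. \<Sum>j\<in>S. a i j * \<xi> i * \<xi> j) > 0"
    and "\<And>\<xi>. (\<Sum>i\<in>S. \<Sum>j\<in>S. h i j * \<xi> i * \<xi> j) \<le> 0"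
  shows "(\<Sum>i\<in>S. \<Sum>j\<in>S. a i j * h i j) \<le> 0"
  using assms
proof (induction S arbitrary: a rule: finite_induct)
  case (insert k S)
  note sym = insert.prems(1) and pos = insert.prems(2) and neg = insert.prems(3)
  have split: "(\<Sum>i\<in>insert k S. \<Sum>j\<in>insert k S. g i j)
      = g k k + (\<Sum>j\<in>S. g k j) + (\<Sum>i\<in>S. g i k) + (\<Sum>i\<in>S. \<Sum>j\<in>S. g i j)" for g :: "'i \<Rightarrow> 'i \<Rightarrow> real"
    using insert(1,2) by (simp add: sum.distrib)
  have zero: "(\<Sum>i\<in>S. f i * (if i = k then 1 else 0)) = 0" for f :: "'i \<Rightarrow> real"
    using insert(2) by (intro sum.neutral) auto
  have akk: "a k k > 0"
    using pos[of "\<lambda>i. if i = k then 1 else 0"] unfolding split zero by (simp add: zero)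
  define a' where "a' i j = a i j - a i k * a j k / a k k" for i j
  have "(\<Sum>i\<in>S. \<Sum>j\<in>S. a' i j * h i j) \<le> 0"
  proof (rule insert.IH)
    show "a' i j = a' j i" if "i \<in> S" "j \<in> S" for i j
      using sym that by (simp add: a'_def)
    show "(\<Sum>i\<in>S. \<Sum>j\<in>S. h i j * \<xi> i * \<xi> j) \<le> 0" for \<xi>
    proof -
      have *: "(\<Sum>i\<in>S. \<Sum>j\<in>S. h i j * (if i = k then 0 else \<xi> i) * (if j = k then 0 else \<xi> j))
        = (\<Sum>i\<in>S. \<Sum>j\<in>S. h i j * \<xi> i * \<xi> j)"
        using insert(2) by (intro sum.cong) auto
      show ?thesis
        using neg[of "\<lambda>i. if i = k then 0 else \<xi> i"] unfolding split * by simp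
    qed
    show "(\<Sum>i\<in>S. \<Sum>j\<in>S. a' i j * \<xi> i * \<xi> j) > 0" if "\<exists>i\<in>S. \<xi> i \<noteq> 0" for \<xi>
    proof -
      define \<sigma> where "\<sigma> = (\<Sum>i\<in>S. a i k * \<xi> i)"
      \<comment> \<open>The entry at \<open>k\<close> minimises the form of \<open>a\<close> over
        that coordinate. Completing the square shows that the minimum is the form of
        \<open>a'\<close> at \<open>\<xi>\<close>.\<close>
      define \<zeta> where "\<zeta> i = (if i = k then - \<sigma> / a k k else \<xi> i)" for i
      have \<zeta>: "\<zeta> i = \<xi> i" if "i \<in> S" for i using that insert(2) by (auto simp: \<zeta>_def)
      have "\<exists>i\<in>insert k S. \<zeta> i \<noteq> 0" using that \<zeta> by auto
      then have "0 < (\<Sum>i\<in>insert k S. \<Sum>j\<in>insert k S. a i j * \<zeta> i * \<zeta> j)" by (rule pos)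
      also have "\<dots> = a k k * \<zeta> k * \<zeta> k + (\<Sum>j\<in>S. a k j * \<zeta> k * \<zeta> j) + (\<Sum>i\<in>S. a i k * \<zeta> i * \<zeta> k)
          + (\<Sum>i\<in>S. \<Sum>j\<in>S. a i j * \<zeta> i * \<zeta> j)" by (rule split)
      also have "(\<Sum>j\<in>S. a k j * \<zeta> k * \<zeta> j) = \<zeta> k * \<sigma>"
        unfolding \<sigma>_def sum_distrib_left using sym \<zeta> by (intro sum.cong) auto
      also have "(\<Sum>j\<in>S. a j k * \<zeta> j * \<zeta> k) = \<zeta> k * \<sigma>"
        unfolding \<sigma>_def sum_distrib_left using \<zeta> by (intro sum.cong) auto
      also have "(\<Sum>i\<in>S. \<Sum>j\<in>S. a i j * \<zeta> i * \<zeta> j) = (\<Sum>i\<in>S. \<Sum>j\<in>S. a i j * \<xi> i * \<xi> j)"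
        using \<zeta> by (intro sum.cong) auto
      also have "a k k * \<zeta> k * \<zeta> k + \<zeta> k * \<sigma> + \<zeta> k * \<sigma> + (\<Sum>i\<in>S. \<Sum>j\<in>S. a i j * \<xi> i * \<xi> j)
         = (\<Sum>i\<in>S. \<Sum>j\<in>S. a i j * \<xi> i * \<xi> j) - \<sigma> * \<sigma> / a k k"
        using akk by (simp add: \<zeta>_def field_simps)
      also have "\<sigma> * \<sigma> / a k k = (\<Sum>i\<in>S. \<Sum>j\<in>S. (a i k * a j k / a k k) * \<xi> i * \<xi> j)"
        unfolding \<sigma>_def sum_product sum_divide_distrib by (intro sum.cong) auto
      finally show ?thesis
        unfolding a'_def by (simp add: sum_subtractf[symmetric] algebra_simps)
    qed
  qed
  \<comment> \<open>\<open>a\<close> is \<open>a'\<close> plus a rank-one matrix. Contracting the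
    rank-one part with \<open>h\<close> gives the form of \<open>h\<close> at the vector
    \<open>\<lambda>i. a i k\<close>, divided by \<open>a k k\<close>; row and column
    \<open>k\<close> of \<open>a'\<close> vanish.\<close>
  moreover have "(\<Sum>i\<in>insert k S. \<Sum>j\<in>insert k S. a i j * h i j)
     = (\<Sum>i\<in>insert k S. \<Sum>j\<in>insert k S. h i j * a i k * a j k) / a k k
       + (\<Sum>i\<in>insert k S. \<Sum>j\<in>insert k S. a' i j * h i j)"
    unfolding sum_divide_distrib sum.distrib[symmetric] using akk
    by (intro sum.cong) (auto simp: a'_def field_simps)
  moreover have "(\<Sum>i\<in>insert k S. \<Sum>j\<in>insert k S. a' i j * h i j) = (\<Sum>i\<in>S. \<Sum>j\<in>S. a' i j * h i j)"
  proof -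
    have "a' k j = 0" "a' j k = 0" if "j \<in> insert k S" for j
      using akk sym that by (auto simp: a'_def)
    then show ?thesis unfolding split by simp
  qed
  moreover have "(\<Sum>i\<in>insert k S. \<Sum>j\<in>insert k S. h i j * a i k * a j k) / a k k \<le> 0"
    using neg[of "\<lambda>i. a i k"] akk by (simp add: divide_nonpos_pos)
  ultimately show ?case by linarith
qed simp

section \<open>Functions with explicit first and second derivatives\<close>

text \<open>The gradient \<open>G\<close> and the Hessian \<open>D\<close> are parameters, not terms
  in \<open>partial\<close>. Sums, translates and the explicit barrier can thus be handled without
  evaluating \<open>deriv\<close>. In \<open>D i j\<close> the differentiation in direction
  \<open>j\<close> comes first.\<close>

definition has_jet2 ::
  "'a::euclidean_space set \<Rightarrow> ('a \<Rightarrow> real) \<Rightarrow> ('a \<Rightarrow> 'a \<Rightarrow> real) \<Rightarrow> ('a \<Rightarrow> 'a \<Rightarrow> 'a \<Rightarrow> real) \<Rightarrow> bool" where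
  "has_jet2 S v G D \<longleftrightarrow> (\<forall>x\<in>S.
     (v has_derivative (\<lambda>h. \<Sum>j\<in>Basis. (h \<bullet> j) * G j x)) (at x) \<and>
     (\<forall>j\<in>Basis. (G j has_derivative (\<lambda>h. \<Sum>i\<in>Basis. (h \<bullet> i) * D i j x)) (at x)))"

text \<open>Unfolding \<open>Ck_on\<close> twice gives continuous partial derivatives both of
  \<open>u\<close> and of each \<open>partial j u\<close>, so the preceding differentiability
  criterion applies at both orders.\<close>

lemma Ck_on_2_has_jet2:
  assumes "open S" "Ck_on 2 S u"
  shows "has_jet2 S u (\<lambda>j. partial j u) (\<lambda>i j. partial i (partial j u))"
proof -
  have D: "((\<lambda>t. w (x + t *\<^sub>R e)) has_real_derivative partial e w x) (at 0)"
    if "(\<lambda>t. w (x + t *\<^sub>R e)) field_differentiable (at 0)" for w :: "'a \<Rightarrow> real" and e x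
    using that DERIV_deriv_iff_field_differentiable unfolding partial_def by blast
  show ?thesis
    unfolding has_jet2_def using assms(2)
    by (auto simp: numeral_2_eq_2 intro!: has_derivative_continuous_partials[OF assms(1)] D)
qed

lemma has_jet2_linear_combination:
  assumes "has_jet2 S v G D" "has_jet2 S v' G' D'"
  shows "has_jet2 S (\<lambda>x. p * v x + q * v' x) (\<lambda>j x. p * G j x + q * G' j x)
    (\<lambda>i j x. p * D i j x + q * D' i j x)"
proof -
  have *: "((\<lambda>x. p * w x + q * w' x) has_derivative (\<lambda>h. \<Sum>j\<in>Basis. (h \<bullet> j) * (p * W j + q * W' j))) (at x)"
    if "(w has_derivative (\<lambda>h. \<Sum>j\<in>Basis. (h \<bullet> j) * W j)) (at x)"
       "(w' has_derivative (\<lambda>h. \<Sum>j\<in>Basis. (h \<bullet> j) * W' j)) (at x)" for w w' :: "'a \<Rightarrow> real" and W W' x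
  proof -
    have "((\<lambda>x. p * w x + q * w' x) has_derivative
       (\<lambda>h. p * (\<Sum>j\<in>Basis. (h \<bullet> j) * W j) + q * (\<Sum>j\<in>Basis. (h \<bullet> j) * W' j))) (at x)"
      by (intro derivative_intros that)
    then show ?thesis by (simp add: sum_distrib_left sum.distrib algebra_simps)
  qed
  show ?thesis using assms unfolding has_jet2_def by (auto intro!: *)
qed

lemma has_jet2_translate:
  assumes "has_jet2 S v G D" "\<And>x. x \<in> S \<Longrightarrow> x + p \<in> S"
  shows "has_jet2 S (\<lambda>x. v (x + p)) (\<lambda>j x. G j (x + p)) (\<lambda>i j x. D i j (x + p))"
proof -
  have *: "((\<lambda>x. w (x + p)) has_derivative W) (at x)"
    if "(w has_derivative W) (at (x + p))" for w :: "'a \<Rightarrow> real" and W x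
  proof -
    have "((\<lambda>x. x + p) has_derivative (\<lambda>h. h)) (at x)"
      by (auto intro!: derivative_eq_intros)
    from has_derivative_compose[OF this that] show ?thesis .
  qed
  show ?thesis using assms unfolding has_jet2_def by (auto intro!: *)
qed

text \<open>Serves the barrier, each of whose two summands depends on a single coordinate.\<close>

lemma has_jet2_ridge:
  fixes e :: "'a::euclidean_space"
  assumes "e \<in> Basis"
    and p: "\<And>t. (p has_real_derivative p' t) (at t)" "\<And>t. (p' has_real_derivative p'' t) (at t)"
  shows "has_jet2 S (\<lambda>x. p (x \<bullet> e)) (\<lambda>j x. if j = e then p' (x \<bullet> e) else 0)
    (\<lambda>i j x. if i = e \<and> j = e then p'' (x \<bullet> e) else 0)"
proof -
  have *: "((\<lambda>x. q (x \<bullet> e)) has_derivative (\<lambda>h. (h \<bullet> e) * q')) (at x)"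
    if "(q has_real_derivative q') (at (x \<bullet> e))" for q q' x
  proof -
    have "((\<lambda>x. x \<bullet> e) has_derivative (\<lambda>h. h \<bullet> e)) (at x)"
      by (auto intro!: derivative_eq_intros)
    from has_derivative_compose[OF this that[unfolded has_field_derivative_def]]
    show ?thesis by (simp add: mult.commute)
  qed
  have **: "(\<Sum>j\<in>Basis. (h \<bullet> j) * (if j = e then r else 0)) = (h \<bullet> e) * r" for h r
    using assms(1) by (simp add: if_distrib sum.delta cong: if_cong)
  show ?thesis unfolding has_jet2_def
  proof (intro ballI conjI)
    fix x
    show "((\<lambda>x. p (x \<bullet> e)) has_derivative (\<lambda>h. \<Sum>j\<in>Basis. (h \<bullet> j) * (if j = e then p' (x \<bullet> e) else 0))) (at x)"
      unfolding ** using *[OF p(1)] .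
    fix j :: 'a assume "j \<in> Basis"
    show "((\<lambda>x. if j = e then p' (x \<bullet> e) else 0) has_derivative
       (\<lambda>h. \<Sum>i\<in>Basis. (h \<bullet> i) * (if i = e \<and> j = e then p'' (x \<bullet> e) else 0))) (at x)"
      using *[OF p(2), of x] by (cases "j = e") (simp_all add: **)
  qed
qed

section \<open>Derivative tests at a maximum\<close>

text \<open>If \<open>l\<close> were positive, \<open>\<phi>'\<close>, which vanishes at 0, would be
  positive just to the right of 0, and the mean value theorem would produce a value above
  \<open>\<phi> 0\<close>.\<close>

lemma second_derivative_nonpos_at_local_max:
  fixes \<phi> \<phi>' :: "real \<Rightarrow> real"
  assumes "r > 0"
    and d1: "\<And>t. \<bar>t\<bar> < r \<Longrightarrow> (\<phi> has_real_derivative \<phi>' t) (at t)"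
    and d2: "(\<phi>' has_real_derivative l) (at 0)"
    and max: "\<And>t. \<bar>t\<bar> < r \<Longrightarrow> \<phi> t \<le> \<phi> 0"
  shows "\<phi>' 0 = 0" "l \<le> 0"
proof -
  show 0: "\<phi>' 0 = 0"
    using DERIV_local_max[OF d1[of 0] \<open>r > 0\<close>] max \<open>r > 0\<close> by auto
  show "l \<le> 0"
  proof (rule ccontr)
    assume "\<not> l \<le> 0"
    then obtain d where d: "d > 0" "\<And>h. 0 < h \<Longrightarrow> h < d \<Longrightarrow> \<phi>' h > 0"
      using DERIV_pos_inc_right[OF d2] 0 by auto
    define t where "t = min d r / 2"
    have t: "0 < t" "t < d" "t < r" using d(1) \<open>r > 0\<close> by (auto simp: t_def)
    have "\<exists>z>0. z < t \<and> \<phi> t - \<phi> 0 = (t - 0) * \<phi>' z"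
      using t by (intro MVT2 d1) auto
    then obtain z where z: "0 < z" "z < t" "\<phi> t - \<phi> 0 = t * \<phi>' z" by auto
    then have "0 < \<phi> t - \<phi> 0" using d(2)[of z] t by simp
    then show False using max[of t] t by auto
  qed
qed

text \<open>On the line through \<open>x\<close> in direction \<open>\<xi>\<close> the two sums are
  the first and second derivatives at parameter 0, which reduces both claims to one
  variable.\<close>

lemma jet2_at_local_max:
  assumes "open S" "x \<in> S" "has_jet2 S v G D"
    and max: "\<And>y. y \<in> S \<Longrightarrow> v y \<le> v x"
  shows "(\<Sum>j\<in>Basis. (\<xi> \<bullet> j) * G j x) = 0"
    and "(\<Sum>i\<in>Basis. \<Sum>j\<in>Basis. D i j x * (\<xi> \<bullet> i) * (\<xi> \<bullet> j)) \<le> 0"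
proof -
  have "open ((\<lambda>t::real. x + t *\<^sub>R \<xi>) -` S)"
    using \<open>open S\<close> by (intro open_vimage continuous_intros)
  moreover have "0 \<in> (\<lambda>t::real. x + t *\<^sub>R \<xi>) -` S" using \<open>x \<in> S\<close> by simp
  ultimately obtain r where "r > 0" "ball 0 r \<subseteq> (\<lambda>t::real. x + t *\<^sub>R \<xi>) -` S"
    using open_contains_ball by blast
  then have r: "r > 0" "\<And>t. \<bar>t\<bar> < r \<Longrightarrow> x + t *\<^sub>R \<xi> \<in> S"
    by (auto simp: subset_iff dist_real_def)
  have chain: "((\<lambda>t. w (x + t *\<^sub>R \<xi>)) has_real_derivative (\<Sum>j\<in>Basis. (\<xi> \<bullet> j) * W j)) (at t)"
    if "(w has_derivative (\<lambda>h. \<Sum>j\<in>Basis. (h \<bullet> j) * W j)) (at (x + t *\<^sub>R \<xi>))" for w :: "'a \<Rightarrow> real" and W t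
  proof -
    have "((\<lambda>t. x + t *\<^sub>R \<xi>) has_derivative (\<lambda>s. s *\<^sub>R \<xi>)) (at t)"
      by (auto intro!: derivative_eq_intros)
    from has_derivative_compose[OF this that] show ?thesis
      unfolding has_field_derivative_def
      by (rule has_derivative_eq_rhs) (simp add: fun_eq_iff sum_distrib_left mult_ac)
  qed
  let ?\<phi> = "\<lambda>t. v (x + t *\<^sub>R \<xi>)" and ?\<phi>' = "\<lambda>t. \<Sum>j\<in>Basis. (\<xi> \<bullet> j) * G j (x + t *\<^sub>R \<xi>)"
  have d1: "(?\<phi> has_real_derivative ?\<phi>' t) (at t)" if "\<bar>t\<bar> < r" for t
    using assms(3) r(2)[OF that] unfolding has_jet2_def by (intro chain) auto
  have d2: "(?\<phi>' has_real_derivative (\<Sum>j\<in>Basis. (\<xi> \<bullet> j) * (\<Sum>i\<in>Basis. (\<xi> \<bullet> i) * D i j x))) (at 0)"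
    using assms(2,3) unfolding has_jet2_def
    by (intro DERIV_sum DERIV_cmult chain) auto
  have m: "?\<phi> t \<le> ?\<phi> 0" if "\<bar>t\<bar> < r" for t using max[OF r(2)[OF that]] by simp
  show "(\<Sum>j\<in>Basis. (\<xi> \<bullet> j) * G j x) = 0"
    using second_derivative_nonpos_at_local_max(1)[OF r(1) d1 d2 m] by simp
  have "(\<Sum>j\<in>Basis. (\<xi> \<bullet> j) * (\<Sum>i\<in>Basis. (\<xi> \<bullet> i) * D i j x)) \<le> 0"
    using second_derivative_nonpos_at_local_max(2)[OF r(1) d1 d2 m] by simp
  also have "(\<Sum>j\<in>Basis. (\<xi> \<bullet> j) * (\<Sum>i\<in>Basis. (\<xi> \<bullet> i) * D i j x))
     = (\<Sum>i\<in>Basis. \<Sum>j\<in>Basis. D i j x * (\<xi> \<bullet> i) * (\<xi> \<bullet> j))"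
    unfolding sum_distrib_left by (subst sum.swap) (simp add: mult_ac)
  finally show "(\<Sum>i\<in>Basis. \<Sum>j\<in>Basis. D i j x * (\<xi> \<bullet> i) * (\<xi> \<bullet> j)) \<le> 0" .
qed

lemma has_jet2_subset: "has_jet2 S v G D \<Longrightarrow> T \<subseteq> S \<Longrightarrow> has_jet2 T v G D"
  unfolding has_jet2_def by blast

section \<open>The elliptic operator at a nonnegative maximum\<close>

text \<open>With the derivatives as separate arguments, linearity in the triple \<open>v\<close>,
  \<open>G\<close>, \<open>D\<close> is a purely algebraic identity.\<close>

definition elliptic_op ::
  "('a::euclidean_space \<Rightarrow> 'a \<Rightarrow> 'a \<Rightarrow> real) \<Rightarrow> ('a \<Rightarrow> 'a \<Rightarrow> real) \<Rightarrow> ('a \<Rightarrow> real) \<Rightarrow>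
   ('a \<Rightarrow> real) \<Rightarrow> ('a \<Rightarrow> 'a \<Rightarrow> real) \<Rightarrow> ('a \<Rightarrow> 'a \<Rightarrow> 'a \<Rightarrow> real) \<Rightarrow> 'a \<Rightarrow> real" where
  "elliptic_op a b c v G D x =
     (\<Sum>i\<in>Basis. \<Sum>j\<in>Basis. a i j x * D i j x) + (\<Sum>i\<in>Basis. b i x * G i x) + c x * v x"

lemma elliptic_op_linear_combination:
  "elliptic_op a b c (\<lambda>x. p * v x + q * v' x) (\<lambda>j x. p * G j x + q * G' j x)
     (\<lambda>i j x. p * D i j x + q * D' i j x) x
   = p * elliptic_op a b c v G D x + q * elliptic_op a b c v' G' D' x"
  unfolding elliptic_op_def
  by (simp add: distrib_left mult.left_commute[of _ p] mult.left_commute[of _ q] sum.distrib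
      flip: sum_distrib_left)

lemma elliptic_op_ridge:
  assumes "e \<in> Basis"
  shows "elliptic_op a b c (\<lambda>x. p (x \<bullet> e)) (\<lambda>j x. if j = e then p' (x \<bullet> e) else 0)
      (\<lambda>i j x. if i = e \<and> j = e then p'' (x \<bullet> e) else 0) x
    = a e e x * p'' (x \<bullet> e) + b e x * p' (x \<bullet> e) + c x * p (x \<bullet> e)"
proof -
  have 1: "(\<Sum>i\<in>Basis. f i * (if i = e then r else 0)) = f e * r" for f :: "'a \<Rightarrow> real" and r
    using assms by (simp add: if_distrib sum.delta cong: if_cong)
  have 2: "(\<Sum>j\<in>Basis. a i j x * (if i = e \<and> j = e then r else 0)) = a i e x * (if i = e then r else 0)" for i r
    using 1[of "\<lambda>j. a i j x" r] by (cases "i = e") auto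
  show ?thesis unfolding elliptic_op_def 1 2 ..
qed

text \<open>At the maximum the gradient vanishes, the Hessian form is nonpositive and so is its
  contraction with \<open>a\<close>; the zeroth-order term has the right sign because
  \<open>c x \<le> 0 \<le> v x\<close>.\<close>

lemma elliptic_op_nonpos_at_max:
  assumes "open S" "x \<in> S" "has_jet2 S v G D"
    and max: "\<And>y. y \<in> S \<Longrightarrow> v y \<le> v x" and "v x \<ge> 0" "c x \<le> 0"
    and sym: "\<And>i j. i \<in> Basis \<Longrightarrow> j \<in> Basis \<Longrightarrow> a i j x = a j i x"
    and pos: "\<And>\<xi>. \<xi> \<noteq> 0 \<Longrightarrow> (\<Sum>i\<in>Basis. \<Sum>j\<in>Basis. a i j x * (\<xi> \<bullet> i) * (\<xi> \<bullet> j)) > 0"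
  shows "elliptic_op a b c v G D x \<le> 0"
proof -
  have "G i x = 0" if "i \<in> Basis" for i
    using jet2_at_local_max(1)[OF assms(1-3) max, of i] that
    by (simp add: inner_Basis if_distrib[of "\<lambda>t. t * _"] sum.delta cong: if_cong)
  moreover have "(\<Sum>i\<in>Basis. \<Sum>j\<in>Basis. a i j x * D i j x) \<le> 0"
  proof (rule pos_def_contraction_nonpos)
    fix \<xi> :: "'a \<Rightarrow> real"
    \<comment> \<open>The contraction lemma speaks of coefficient families, the derivative test of
      vectors; \<open>z\<close> is the vector with coordinates \<open>\<xi>\<close>.\<close>
    define z where "z = (\<Sum>i\<in>Basis. \<xi> i *\<^sub>R i)"
    have z: "z \<bullet> i = \<xi> i" if "i \<in> Basis" for i using that by (simp add: z_def)
    show "(\<Sum>i\<in>Basis. \<Sum>j\<in>Basis. D i j x * \<xi> i * \<xi> j) \<le> 0"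
      using jet2_at_local_max(2)[OF assms(1-3) max, of z] by (simp add: z)
    show "(\<Sum>i\<in>Basis. \<Sum>j\<in>Basis. a i j x * \<xi> i * \<xi> j) > 0" if "\<exists>i\<in>Basis. \<xi> i \<noteq> 0"
    proof -
      have "z \<noteq> 0" using that z by force
      from pos[OF this] show ?thesis by (simp add: z)
    qed
  qed (use sym in auto)
  moreover have "c x * v x \<le> 0" using assms by (simp add: mult_nonpos_nonneg)
  ultimately show ?thesis by (simp add: elliptic_op_def)
qed

section \<open>Comparison on the unbounded cylinder\<close>

text \<open>The barrier \<open>\<phi>\<close> is kept abstract: its growth in the first coordinate
  makes up for the missing compactness, and its strictness yields the contradiction, since
  \<open>w\<close> is only a weak subsolution.\<close>

lemma nonpos_on_cylinder:
  fixes U :: "'b::euclidean_space set" and w :: "real \<times> 'b \<Rightarrow> real"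
  assumes "open U" "bounded U"
    and w: "has_jet2 (UNIV \<times> U) w G D" "\<And>x. x \<in> UNIV \<times> U \<Longrightarrow> elliptic_op a b c w G D x \<ge> 0"
      "continuous_on (UNIV \<times> closure U) w" "\<And>x. x \<in> UNIV \<times> closure U \<Longrightarrow> w x \<le> B"
      "\<And>x. x \<in> UNIV \<times> frontier U \<Longrightarrow> w x \<le> 0"
    and \<phi>: "has_jet2 UNIV \<phi> G' D'" "\<And>x. x \<in> UNIV \<times> U \<Longrightarrow> elliptic_op a b c \<phi> G' D' x < 0"
      "\<And>x. x \<in> UNIV \<times> closure U \<Longrightarrow> \<bar>fst x\<bar> \<le> \<phi> x"
    and c: "\<And>x. x \<in> UNIV \<times> U \<Longrightarrow> c x \<le> 0"
    and sym: "\<And>x i j. x \<in> UNIV \<times> U \<Longrightarrow> i \<in> Basis \<Longrightarrow> j \<in> Basis \<Longrightarrow> a i j x = a j i x"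
    and pos: "\<And>x \<xi>. x \<in> UNIV \<times> U \<Longrightarrow> \<xi> \<noteq> 0 \<Longrightarrow>
        (\<Sum>i\<in>Basis. \<Sum>j\<in>Basis. a i j x * (\<xi> \<bullet> i) * (\<xi> \<bullet> j)) > 0"
    and x: "x \<in> UNIV \<times> closure U"
  shows "w x \<le> 0"
proof (rule ccontr)
  assume "\<not> w x \<le> 0"
  \<comment> \<open>This gives \<open>\<epsilon> * \<phi> x = w x / 2 - \<epsilon>\<close>, which is
    below \<open>w x\<close>; the summand 1 keeps the denominator positive.\<close>
  define \<epsilon> where "\<epsilon> = w x / (2 * (\<phi> x + 1))"
  have "\<phi> x \<ge> 0" using \<phi>(3)[OF x] by linarith
  have \<epsilon>: "\<epsilon> > 0" "\<epsilon> * \<phi> x < w x"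
  proof -
    show "\<epsilon> > 0" using \<open>\<not> w x \<le> 0\<close> \<open>\<phi> x \<ge> 0\<close> by (simp add: \<epsilon>_def)
    then have "0 \<le> \<epsilon> * \<phi> x" using \<open>\<phi> x \<ge> 0\<close> by simp
    moreover have "2 * (\<epsilon> * \<phi> x) + 2 * \<epsilon> = w x"
      using \<open>\<phi> x \<ge> 0\<close> by (simp add: \<epsilon>_def divide_simps) (simp add: algebra_simps)
    ultimately show "\<epsilon> * \<phi> x < w x" using \<open>\<epsilon> > 0\<close> by linarith
  qed
  \<comment> \<open>Written with both factors so as to match the linear combination lemmas.\<close>
  define v where "v = (\<lambda>x. 1 * w x + (- \<epsilon>) * \<phi> x)"
  have jet: "has_jet2 (UNIV \<times> U) v (\<lambda>j x. 1 * G j x + (- \<epsilon>) * G' j x) (\<lambda>i j x. 1 * D i j x + (- \<epsilon>) * D' i j x)"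
    unfolding v_def by (intro has_jet2_linear_combination w has_jet2_subset[OF \<phi>(1)]) auto
  \<comment> \<open>Where \<open>v\<close> is positive,
    \<open>\<epsilon> * \<bar>fst z\<bar> < w z \<le> B\<close>, so all positive values of
    \<open>v\<close> occur in this compact set.\<close>
  define K where "K = {- B / \<epsilon>..B / \<epsilon>} \<times> closure U"
  have inside: "z \<in> UNIV \<times> U \<and> \<bar>fst z\<bar> < B / \<epsilon>" if z: "z \<in> UNIV \<times> closure U" "v z > 0" for z
  proof -
    have "\<epsilon> * \<bar>fst z\<bar> \<le> \<epsilon> * \<phi> z" using \<phi>(3)[OF z(1)] \<epsilon>(1) by simp
    then have "\<epsilon> * \<bar>fst z\<bar> < w z" using z(2) by (simp add: v_def)
    moreover have "0 \<le> \<epsilon> * \<bar>fst z\<bar>" using \<epsilon>(1) by simp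
    ultimately have "\<not> w z \<le> 0" "\<epsilon> * \<bar>fst z\<bar> < B" using w(4)[OF z(1)] by linarith+
    moreover have "closure U = U \<union> frontier U"
      by (simp add: closure_Un_frontier)
    ultimately show ?thesis using w(5)[of z] z(1) \<epsilon>(1) by (auto simp: field_simps)
  qed
  have vx: "v x > 0" using \<epsilon> by (simp add: v_def)
  have "x \<in> K" using inside[OF x vx] x by (auto simp: K_def mem_Times_iff abs_less_iff)
  have "isCont \<phi> y" for y
    using \<phi>(1) has_derivative_continuous unfolding has_jet2_def by blast
  then have "continuous_on K \<phi>" by (simp add: continuous_at_imp_continuous_on)
  moreover have "continuous_on K w" using w(3) by (rule continuous_on_subset) (auto simp: K_def)
  ultimately have "continuous_on K v"
    unfolding v_def by (intro continuous_on_add continuous_on_mult continuous_on_const)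
  moreover have "compact K"
    unfolding K_def using \<open>bounded U\<close> by (intro compact_Times) (auto simp: compact_closure)
  ultimately obtain z where z: "z \<in> K" "\<And>y. y \<in> K \<Longrightarrow> v y \<le> v z"
    using continuous_attains_sup[of K v] \<open>x \<in> K\<close> by blast
  have vz: "v z > 0" using z(2)[OF \<open>x \<in> K\<close>] vx by linarith
  have "z \<in> UNIV \<times> U" "\<bar>fst z\<bar> < B / \<epsilon>" using inside[of z] vz z(1) by (auto simp: K_def)
  \<comment> \<open>The derivative test needs an open set: this open part of \<open>K\<close>
    contains \<open>z\<close>, because \<open>v z > 0\<close> excludes the ends and the lateral
    boundary.\<close>
  define S where "S = {- B / \<epsilon><..<B / \<epsilon>} \<times> U"
  have S: "open S" "z \<in> S" "S \<subseteq> UNIV \<times> U" "S \<subseteq> K"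
    using \<open>open U\<close> \<open>z \<in> UNIV \<times> U\<close> \<open>\<bar>fst z\<bar> < B / \<epsilon>\<close> closure_subset
    by (auto simp: S_def K_def open_Times mem_Times_iff abs_less_iff)
  have "elliptic_op a b c v (\<lambda>j x. 1 * G j x + (- \<epsilon>) * G' j x) (\<lambda>i j x. 1 * D i j x + (- \<epsilon>) * D' i j x) z \<le> 0"
    using S z(2) vz \<open>z \<in> UNIV \<times> U\<close>
    by (intro elliptic_op_nonpos_at_max[OF S(1,2) has_jet2_subset[OF jet]] c sym pos) auto
  then have "elliptic_op a b c w G D z \<le> \<epsilon> * elliptic_op a b c \<phi> G' D' z"
    unfolding v_def elliptic_op_linear_combination by simp
  moreover have "\<epsilon> * elliptic_op a b c \<phi> G' D' z < 0"
    using \<epsilon>(1) \<phi>(2) \<open>z \<in> UNIV \<times> U\<close> by (simp add: mult_pos_neg)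
  ultimately show False using w(2)[OF \<open>z \<in> UNIV \<times> U\<close>] by linarith
qed

section \<open>Construction of the growing strict supersolution\<close>

text \<open>The operator sends the \<open>e1\<close> summand to at most \<open>2 * H\<close> and the
  \<open>e2\<close> summand to at most \<open>- (2 * H + 1)\<close>. The growth bound holds wherever
  \<open>\<bar>x \<bullet> e2\<bar> \<le> R\<close>, so it can also be used on the closure of
  \<open>S\<close>.\<close>

lemma growing_supersolution_exists:
  fixes e1 e2 :: "'a::euclidean_space"
  assumes e: "e1 \<in> Basis" "e2 \<in> Basis" and "H \<ge> 0" "l > 0"
    and coeff: "\<And>x. x \<in> S \<Longrightarrow> \<bar>a e1 e1 x\<bar> \<le> H \<and> \<bar>b e1 x\<bar> \<le> H \<and> l \<le> a e2 e2 x \<and> \<bar>b e2 x\<bar> \<le> H \<and> c x \<le> 0"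
    and R: "\<And>x. x \<in> S \<Longrightarrow> \<bar>x \<bullet> e2\<bar> \<le> R"
  shows "\<exists>\<phi> G D. has_jet2 UNIV \<phi> G D \<and> (\<forall>x\<in>S. elliptic_op a b c \<phi> G D x < 0) \<and>
    (\<forall>x. \<bar>x \<bullet> e2\<bar> \<le> R \<longrightarrow> \<bar>x \<bullet> e1\<bar> \<le> \<phi> x)"
proof -
  \<comment> \<open>A smooth majorant of \<open>\<bar>t\<bar>\<close> whose first two derivatives
    are bounded by 1.\<close>
  define p where "p t = sqrt (1 + t\<^sup>2)" for t :: real
  define p' where "p' t = t / sqrt (1 + t\<^sup>2)" for t :: real
  define p'' where "p'' t = 1 / (sqrt (1 + t\<^sup>2) * (1 + t\<^sup>2))" for t :: real
  have pos: "1 + t\<^sup>2 > 0" for t :: real by (simp add: add_pos_nonneg)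
  have p: "(p has_real_derivative p' t) (at t)" for t
    unfolding p_def p'_def using pos[of t] by (auto intro!: derivative_eq_intros simp: field_simps)
  have p': "(p' has_real_derivative p'' t) (at t)" for t
  proof -
    have "((\<lambda>t. t / sqrt (1 + t\<^sup>2)) has_real_derivative
        (1 * sqrt (1 + t\<^sup>2) - t * (t / sqrt (1 + t\<^sup>2))) / (sqrt (1 + t\<^sup>2) * sqrt (1 + t\<^sup>2))) (at t)"
      using pos[of t] p[of t] unfolding p_def p'_def by (intro DERIV_divide DERIV_ident) auto
    also have "(1 * sqrt (1 + t\<^sup>2) - t * (t / sqrt (1 + t\<^sup>2))) = 1 / sqrt (1 + t\<^sup>2)"
      using pos[of t] by (simp add: field_simps power2_eq_square)
    finally show ?thesis using pos[of t] by (simp add: p'_def[abs_def] p''_def)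
  qed
  have abs_p: "\<bar>t\<bar> \<le> p t" for t
    using real_sqrt_le_mono[of "t\<^sup>2" "1 + t\<^sup>2"] by (simp add: p_def)
  have abs_p': "\<bar>p' t\<bar> \<le> 1" for t
    using abs_p[of t] pos[of t] by (simp add: p_def p'_def divide_le_eq)
  have abs_p'': "\<bar>p'' t\<bar> \<le> 1" for t
  proof -
    have "1 * 1 \<le> sqrt (1 + t\<^sup>2) * (1 + t\<^sup>2)" by (intro mult_mono) auto
    then have "0 \<le> p'' t" "p'' t \<le> 1" unfolding p''_def by (simp_all only: divide_le_eq_1) auto
    then show ?thesis by simp
  qed

  \<comment> \<open>Chosen so that \<open>l * \<alpha>\<^sup>2 - H * \<alpha> = \<alpha>\<close>:
    the second-order term outweighs the drift by \<open>\<alpha>\<close>.\<close>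
  define \<alpha> where "\<alpha> = (H + 1) / l"
  have \<alpha>: "\<alpha> > 0" "l * \<alpha> = H + 1" using \<open>H \<ge> 0\<close> \<open>l > 0\<close> by (auto simp: \<alpha>_def)
  \<comment> \<open>The constant makes \<open>q\<close> nonnegative for
    \<open>\<bar>t\<bar> \<le> R\<close>, so that \<open>c x * q t \<le> 0\<close> on
    \<open>S\<close>.\<close>
  define q where "q t = exp (\<alpha> * R) - exp (\<alpha> * t)" for t
  define q' where "q' t = - \<alpha> * exp (\<alpha> * t)" for t
  define q'' where "q'' t = - \<alpha>\<^sup>2 * exp (\<alpha> * t)" for t
  have q: "(q has_real_derivative q' t) (at t)" for t
    unfolding q_def q'_def by (auto intro!: derivative_eq_intros)
  have q': "(q' has_real_derivative q'' t) (at t)" for t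
    unfolding q'_def q''_def by (auto intro!: derivative_eq_intros simp: power2_eq_square)
  have q_nonneg: "q t \<ge> 0" if "\<bar>t\<bar> \<le> R" for t
    using that \<alpha>(1) by (simp add: q_def)
  \<comment> \<open>On \<open>\<bar>t\<bar> \<le> R\<close> the gain
    \<open>\<alpha> * exp (\<alpha> * t)\<close> is at least
    \<open>\<alpha> * exp (- \<alpha> * R)\<close>; \<open>M\<close> scales this lower bound to
    \<open>2 * H + 1\<close>.\<close>
  define M where "M = (2 * H + 1) / (\<alpha> * exp (- \<alpha> * R))"
  have M: "M > 0" "M * (\<alpha> * exp (- \<alpha> * R)) = 2 * H + 1"
    using \<alpha>(1) \<open>H \<ge> 0\<close> by (auto simp: M_def)

  define G where "G = (\<lambda>j x. 1 * (if j = e1 then p' (x \<bullet> e1) else 0) + M * (if j = e2 then q' (x \<bullet> e2) else 0))"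
  define D where "D = (\<lambda>i j x. 1 * (if i = e1 \<and> j = e1 then p'' (x \<bullet> e1) else 0)
    + M * (if i = e2 \<and> j = e2 then q'' (x \<bullet> e2) else 0))"
  define \<phi> where "\<phi> = (\<lambda>x. 1 * p (x \<bullet> e1) + M * q (x \<bullet> e2))"
  have "has_jet2 UNIV \<phi> G D"
    unfolding \<phi>_def G_def D_def
    by (intro has_jet2_linear_combination has_jet2_ridge e p p' q q')
  moreover have "elliptic_op a b c \<phi> G D x < 0" if "x \<in> S" for x
  proof -
    note coeff = coeff[OF that]
    let ?s = "x \<bullet> e1" and ?t = "x \<bullet> e2"
    have "\<bar>a e1 e1 x * p'' ?s\<bar> \<le> H * 1" "\<bar>b e1 x * p' ?s\<bar> \<le> H * 1"
      unfolding abs_mult by (intro mult_mono; use coeff abs_p' abs_p'' \<open>H \<ge> 0\<close> in simp)+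
    moreover have "c x * p ?s \<le> 0" using coeff by (auto simp: p_def intro!: mult_nonpos_nonneg)
    ultimately have 1: "a e1 e1 x * p'' ?s + b e1 x * p' ?s + c x * p ?s \<le> 2 * H" by linarith
    have "l * \<alpha>\<^sup>2 \<le> a e2 e2 x * \<alpha>\<^sup>2" using coeff by (intro mult_right_mono) auto
    moreover have "- b e2 x * \<alpha> \<le> H * \<alpha>" using coeff \<alpha>(1) by (intro mult_right_mono) auto
    moreover have "l * \<alpha>\<^sup>2 = H * \<alpha> + \<alpha>"
      using arg_cong[OF \<alpha>(2), of "\<lambda>t. t * \<alpha>"] by (simp add: power2_eq_square algebra_simps)
    ultimately have "\<alpha> \<le> a e2 e2 x * \<alpha>\<^sup>2 + b e2 x * \<alpha>" by simp
    then have "\<alpha> * exp (\<alpha> * ?t) \<le> (a e2 e2 x * \<alpha>\<^sup>2 + b e2 x * \<alpha>) * exp (\<alpha> * ?t)"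
      by (intro mult_right_mono) auto
    moreover have "\<alpha> * exp (- \<alpha> * R) \<le> \<alpha> * exp (\<alpha> * ?t)"
      using R[OF that] \<alpha>(1) mult_left_mono[of "-R" ?t \<alpha>] by auto
    moreover have "c x * q ?t \<le> 0" using coeff q_nonneg[OF R[OF that]] by (auto intro!: mult_nonpos_nonneg)
    ultimately have "a e2 e2 x * q'' ?t + b e2 x * q' ?t + c x * q ?t \<le> - (\<alpha> * exp (- \<alpha> * R))"
      by (simp add: q'_def q''_def algebra_simps)
    from mult_left_mono[OF this, of M]
    have 2: "M * (a e2 e2 x * q'' ?t + b e2 x * q' ?t + c x * q ?t) \<le> - (2 * H + 1)"
      using M by simp
    show ?thesis
      unfolding \<phi>_def G_def D_def elliptic_op_linear_combination
        elliptic_op_ridge[OF e(1)] elliptic_op_ridge[OF e(2)]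
      unfolding mult_1
      by (rule le_less_trans[OF add_mono[OF 1 2]]) simp
  qed
  moreover have "\<bar>x \<bullet> e1\<bar> \<le> \<phi> x" if "\<bar>x \<bullet> e2\<bar> \<le> R" for x
  proof -
    have "0 \<le> M * q (x \<bullet> e2)" using q_nonneg[OF that] M(1) by simp
    then show ?thesis using abs_p[of "x \<bullet> e1"] by (simp add: \<phi>_def)
  qed
  ultimately show ?thesis by blast
qed

section \<open>Application to the translated solution\<close>

lemma abs_le_C0_norm: "x \<in> S \<Longrightarrow> ereal \<bar>h x\<bar> \<le> C0_norm S h"
  unfolding C0_norm_def by (rule SUP_upper)

lemma periodic_x1_translate:
  fixes h :: "real \<times> 'b::monoid_add \<Rightarrow> real"
  shows "periodic_x1 D T h \<Longrightarrow> x \<in> D \<Longrightarrow> h (x + (T, 0)) = h x"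
  unfolding periodic_x1_def by (cases x) (auto dest!: bspec[of D _ x])

theorem corollary1:
  fixes \<Omega>' :: "(real ^ 'm::finite) set"
    and \<Omega> :: "(real \<times> (real ^ 'm)) set"
    and a :: "real \<times> (real ^ 'm) \<Rightarrow> real \<times> (real ^ 'm) \<Rightarrow> real \<times> (real ^ 'm) \<Rightarrow> real"
    and b :: "real \<times> (real ^ 'm) \<Rightarrow> real \<times> (real ^ 'm) \<Rightarrow> real"
    and c f g u :: "real \<times> (real ^ 'm) \<Rightarrow> real"
    and H \<Lambda> L :: real
  assumes "domain_set \<Omega>'" and "bounded \<Omega>'"
    and "\<Omega> = UNIV \<times> \<Omega>'"
    and "uniform_exterior_sphere \<Omega>"
    and "\<forall>i\<in>Basis. \<forall>j\<in>Basis. continuous_on (closure \<Omega>) (a i j)"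
    and "\<forall>i\<in>Basis. continuous_on (closure \<Omega>) (b i)"
    and "continuous_on (closure \<Omega>) c"
    and "\<forall>x\<in>closure \<Omega>. \<forall>i\<in>Basis. \<forall>j\<in>Basis. a i j x = a j i x"
    and "\<forall>x\<in>closure \<Omega>. \<forall>\<xi>. \<xi> \<noteq> 0 \<longrightarrow>
           (\<Sum>i\<in>Basis. \<Sum>j\<in>Basis. a i j x * (\<xi> \<bullet> i) * (\<xi> \<bullet> j)) > 0"
    and "\<forall>i\<in>Basis. \<forall>j\<in>Basis.
           C0_norm \<Omega> (a i j) + C0_norm \<Omega> (b i) + C0_norm \<Omega> c \<le> ereal H"
    and "\<forall>x\<in>\<Omega>. c x \<le> 0"
    and "\<forall>x\<in>\<Omega>. \<forall>\<xi>.
           1 / \<Lambda> * (norm \<xi>)\<^sup>2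
             \<le> (\<Sum>i\<in>Basis. \<Sum>j\<in>Basis. a i j x * (\<xi> \<bullet> i) * (\<xi> \<bullet> j)) \<and>
           (\<Sum>i\<in>Basis. \<Sum>j\<in>Basis. a i j x * (\<xi> \<bullet> i) * (\<xi> \<bullet> j))
             \<le> \<Lambda> * (norm \<xi>)\<^sup>2"
    and "L > 0"
    and "\<forall>i\<in>Basis. \<forall>j\<in>Basis. periodic_x1 (closure \<Omega>) L (a i j)"
    and "\<forall>i\<in>Basis. periodic_x1 (closure \<Omega>) L (b i)"
    and "periodic_x1 (closure \<Omega>) L c"
    and "periodic_x1 \<Omega> L f"
    and "periodic_x1 (frontier \<Omega>) L g"
    and "Ck_on 2 \<Omega> u" and "continuous_on (closure \<Omega>) u"
    and "bounded (u ` closure \<Omega>)"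
    and "\<forall>x\<in>\<Omega>. (\<Sum>i\<in>Basis. \<Sum>j\<in>Basis. a i j x * partial i (partial j u) x)
             + (\<Sum>i\<in>Basis. b i x * partial i u x) + c x * u x = f x"
    and "\<forall>x\<in>frontier \<Omega>. u x = g x"
  shows "\<exists>T>0. periodic_x1 (closure \<Omega>) T u"
proof (intro exI conjI)
  \<comment> \<open>The period of \<open>u\<close> is \<open>L\<close> itself; this goal fixes the
    witness.\<close>
  show "L > 0" by fact
  note \<Omega> = \<open>\<Omega> = UNIV \<times> \<Omega>'\<close>
  have open': "open \<Omega>'" "\<Omega>' \<noteq> {}" using \<open>domain_set \<Omega>'\<close> by (auto simp: domain_set_def)
  have open\<Omega>: "open \<Omega>" by (simp add: \<Omega> open_Times open')
  have closure: "closure \<Omega> = UNIV \<times> closure \<Omega>'" by (simp add: \<Omega> closure_Times)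
  have frontier: "frontier \<Omega> = UNIV \<times> frontier \<Omega>'"
    by (auto simp: frontier_def closure interior_open open\<Omega> open') (auto simp: \<Omega>)
  have \<Omega>_closure: "x \<in> closure \<Omega>" if "x \<in> \<Omega>" for x using that closure_subset by blast
  let ?p = "(L, 0) :: real \<times> (real ^ 'm)"
  have shift: "x + ?p \<in> \<Omega> \<longleftrightarrow> x \<in> \<Omega>" "x + ?p \<in> closure \<Omega> \<longleftrightarrow> x \<in> closure \<Omega>"
    "x + ?p \<in> frontier \<Omega> \<longleftrightarrow> x \<in> frontier \<Omega>" for x
    unfolding closure frontier by (simp_all add: \<Omega> mem_Times_iff)

  \<comment> \<open>Basis vectors turn ellipticity into bounds on the diagonal entries.\<close>
  have quad: "(\<Sum>i\<in>Basis. \<Sum>j\<in>Basis. a i j x * (e \<bullet> i) * (e \<bullet> j)) = a e e x" if "e \<in> Basis" for e x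
  proof -
    have "(\<Sum>j\<in>Basis. r j * (e \<bullet> j)) = (\<Sum>j\<in>Basis. if j = e then r j else 0)"
      for r :: "real \<times> (real ^ 'm) \<Rightarrow> real"
      using that by (intro sum.cong) (auto simp: inner_Basis)
    then have S: "(\<Sum>j\<in>Basis. r j * (e \<bullet> j)) = r e" for r :: "real \<times> (real ^ 'm) \<Rightarrow> real"
      using that by simp
    show ?thesis unfolding S ..
  qed
  \<comment> \<open>The index type is inhabited, so there is a coordinate of the bounded
    cross-section in which the exponential can be placed.\<close>
  obtain k :: 'm where True by blast
  define e1 where "e1 = (1 :: real, 0 :: real ^ 'm)"
  define e2 where "e2 = (0 :: real, axis k 1 :: real ^ 'm)"
  have e: "e1 \<in> Basis" "e2 \<in> Basis"
    by (auto simp: e1_def e2_def Basis_prod_def axis_in_Basis_iff)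
  obtain x0 where "x0 \<in> \<Omega>" using open'(2) \<Omega> by auto
  have pos: "(\<Sum>i\<in>Basis. \<Sum>j\<in>Basis. a i j x * (\<xi> \<bullet> i) * (\<xi> \<bullet> j)) > 0" if "x \<in> \<Omega>" "\<xi> \<noteq> 0" for x \<xi>
    using assms(9) \<Omega>_closure[OF that(1)] that(2) by blast
  have ell: "1 / \<Lambda> \<le> a i i x" "a i i x \<le> \<Lambda>" "a i i x > 0" if "x \<in> \<Omega>" "i \<in> Basis" for x i
    using assms(12)[rule_format, OF that(1), of i] pos[OF that(1), of i] that(2)
    by (auto simp: quad nonzero_Basis)
  \<comment> \<open>A diagonal entry at \<open>x0\<close> lies strictly above 0 and at most at
    \<open>\<Lambda>\<close>; the supersolution needs \<open>1 / \<Lambda> > 0\<close>.\<close>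
  have "\<Lambda> > 0" using ell[OF \<open>x0 \<in> \<Omega>\<close> e(1)] by linarith
  have bound: "\<bar>a i j x\<bar> + \<bar>b i x\<bar> + \<bar>c x\<bar> \<le> H" if "x \<in> \<Omega>" "i \<in> Basis" "j \<in> Basis" for x i j
  proof -
    have "ereal \<bar>a i j x\<bar> + ereal \<bar>b i x\<bar> + ereal \<bar>c x\<bar> \<le> ereal H"
      using assms(10) that by (blast intro: order_trans add_mono abs_le_C0_norm)
    then show ?thesis by simp
  qed
  have "H \<ge> 0" using bound[OF \<open>x0 \<in> \<Omega>\<close> e(1) e(1)] by linarith
  obtain R where R: "\<And>y. y \<in> closure \<Omega>' \<Longrightarrow> norm y \<le> R"
    using bounded_closure[OF \<open>bounded \<Omega>'\<close>] bounded_iff by blast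
  have Re2: "\<bar>x \<bullet> e2\<bar> \<le> R" if "x \<in> closure \<Omega>" for x
    using that R[of "snd x"] component_le_norm_cart[of "snd x" k]
    by (auto simp: closure e2_def inner_axis inner_prod_def)
  have e1: "x \<bullet> e1 = fst x" for x by (simp add: e1_def inner_prod_def)
  have coeff: "\<bar>a e1 e1 x\<bar> \<le> H \<and> \<bar>b e1 x\<bar> \<le> H \<and> 1 / \<Lambda> \<le> a e2 e2 x \<and> \<bar>b e2 x\<bar> \<le> H \<and> c x \<le> 0"
    if "x \<in> \<Omega>" for x
    using bound[OF that e(1) e(1)] bound[OF that e(2) e(2)] ell(1)[OF that e(2)] assms(11) that by auto
  obtain \<phi> G' D' where \<phi>: "has_jet2 UNIV \<phi> G' D'" "\<And>x. x \<in> \<Omega> \<Longrightarrow> elliptic_op a b c \<phi> G' D' x < 0"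
    "\<And>x. x \<in> closure \<Omega> \<Longrightarrow> \<bar>fst x\<bar> \<le> \<phi> x"
    using growing_supersolution_exists[where S=\<Omega> and a=a and b=b and c=c and l="1 / \<Lambda>",
        OF e \<open>H \<ge> 0\<close> _ coeff Re2[OF \<Omega>_closure]] \<open>\<Lambda> > 0\<close> Re2 by (auto simp: e1)

  let ?G = "\<lambda>j. partial j u" and ?D = "\<lambda>i j. partial i (partial j u)"
  have jet: "has_jet2 \<Omega> u ?G ?D" by (rule Ck_on_2_has_jet2[OF open\<Omega> assms(19)])
  then have jet_shift: "has_jet2 \<Omega> (\<lambda>x. u (x + ?p)) (\<lambda>j x. ?G j (x + ?p)) (\<lambda>i j x. ?D i j (x + ?p))"
    by (rule has_jet2_translate) (simp add: shift)
  have op: "elliptic_op a b c u ?G ?D x = f x" if "x \<in> \<Omega>" for x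
    using assms(22) that by (simp add: elliptic_op_def)
  \<comment> \<open>The translate solves the same equation because the coefficients and
    \<open>f\<close> share the period \<open>L\<close>.\<close>
  have op_shift: "elliptic_op a b c (\<lambda>x. u (x + ?p)) (\<lambda>j x. ?G j (x + ?p)) (\<lambda>i j x. ?D i j (x + ?p)) x = f x"
    if "x \<in> \<Omega>" for x
  proof -
    have "a i j (x + ?p) = a i j x" "b i (x + ?p) = b i x" if "i \<in> Basis" "j \<in> Basis" for i j
      using assms(14,15) that \<Omega>_closure[OF \<open>x \<in> \<Omega>\<close>] by (auto intro!: periodic_x1_translate)
    moreover have "c (x + ?p) = c x"
      using assms(16) \<Omega>_closure[OF \<open>x \<in> \<Omega>\<close>] by (auto intro!: periodic_x1_translate)
    ultimately have "elliptic_op a b c (\<lambda>x. u (x + ?p)) (\<lambda>j x. ?G j (x + ?p)) (\<lambda>i j x. ?D i j (x + ?p)) x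
      = elliptic_op a b c u ?G ?D (x + ?p)"
      unfolding elliptic_op_def by simp
    also have "\<dots> = f (x + ?p)" using that by (simp add: op shift)
    also have "\<dots> = f x" using periodic_x1_translate[OF assms(17) that] .
    finally show ?thesis .
  qed
  obtain B where B: "\<And>x. x \<in> closure \<Omega> \<Longrightarrow> \<bar>u x\<bar> \<le> B"
    using assms(21) by (auto simp: bounded_iff)
  \<comment> \<open>The sign \<open>\<sigma>\<close> covers the difference and its negative in one
    argument.\<close>
  have le: "\<sigma> * u (x + ?p) + (- \<sigma>) * u x \<le> 0" if \<sigma>: "\<bar>\<sigma>\<bar> = 1" and x: "x \<in> closure \<Omega>" for \<sigma> x
  proof (rule nonpos_on_cylinder[where U=\<Omega>' and B="2 * B" and \<phi>=\<phi> and a=a and b=b and c=c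
        and w="\<lambda>x. \<sigma> * u (x + ?p) + (- \<sigma>) * u x", folded \<Omega> closure frontier])
    show "has_jet2 \<Omega> (\<lambda>x. \<sigma> * u (x + ?p) + (- \<sigma>) * u x)
      (\<lambda>j x. \<sigma> * ?G j (x + ?p) + (- \<sigma>) * ?G j x) (\<lambda>i j x. \<sigma> * ?D i j (x + ?p) + (- \<sigma>) * ?D i j x)"
      by (rule has_jet2_linear_combination[OF jet_shift jet])
    show "0 \<le> elliptic_op a b c (\<lambda>x. \<sigma> * u (x + ?p) + (- \<sigma>) * u x)
      (\<lambda>j x. \<sigma> * ?G j (x + ?p) + (- \<sigma>) * ?G j x) (\<lambda>i j x. \<sigma> * ?D i j (x + ?p) + (- \<sigma>) * ?D i j x) x"
      if "x \<in> \<Omega>" for x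
      unfolding elliptic_op_linear_combination op[OF that] op_shift[OF that] by simp
    show "continuous_on (closure \<Omega>) (\<lambda>x. \<sigma> * u (x + ?p) + (- \<sigma>) * u x)"
      by (intro continuous_intros continuous_on_compose2[OF assms(20)] assms(20)) (auto simp: closure)
    show "\<sigma> * u (x + ?p) + (- \<sigma>) * u x \<le> 2 * B" if "x \<in> closure \<Omega>" for x
      using B[of x] B[of "x + ?p"] that \<sigma> by (auto simp: shift abs_if split: if_splits)
    show "\<sigma> * u (x + ?p) + (- \<sigma>) * u x \<le> 0" if "x \<in> frontier \<Omega>" for x
    proof -
      have "u (x + ?p) = u x"
        using assms(23) that periodic_x1_translate[OF assms(18) that] by (simp add: shift)
      then show ?thesis by simp
    qed
    show "a i j x = a j i x" if "x \<in> \<Omega>" "i \<in> Basis" "j \<in> Basis" for x i j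
      using assms(8) \<Omega>_closure that by blast
  qed (fact open' assms(2) assms(11)[rule_format] \<phi> pos x)+
  have "u (x + ?p) = u x" if "x \<in> closure \<Omega>" for x
    using le[of 1 x] le[of "-1" x] that by simp
  from this[of "(s, y)" for s y] show "periodic_x1 (closure \<Omega>) L u"
    using \<open>L > 0\<close> by (auto simp: periodic_x1_def)
qed

end
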